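(* Let $N\ge2$ be an integer. Let $h:[1,\infty)\to\mathbb{R}^+$ be continuous and increasing, with $h(t)\to+\infty$ as $t\to\infty$ and $$\lim_{t\to\infty}\frac{h(t)}{\log\log(et)}=0 .$$ Then $$\sup_{v\in E_N}\int_0^1 e^{\left(\log\frac es+\log\log\frac es+h\left(\frac1s\right)\right)\frac{v^N(s)}{s^{N-1}}}\,ds=\infty .$$
   Context: $E_N:=\left\{u\in W^{1,N}(0,1): u(0)=0,\ \int_0^1|u'|^N\,dx=1\right\}$ (real-valued functions, identified with their continuous representatives), and $v^N(s)=(v(s))^N$. $\mathbb{R}^+$ denotes the nonnegative reals. *)

theory Defs
  imports "HOL-Analysis.Analysis"
begin

text \<open>
  The space \<open>C\<^sub>c\<^sup>\<infinity>(0,1)\<close>, its elements being extended by zero to the whole line. The function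
  spaces below are likewise sets of functions on the whole line of which only the values on
  \<open>(0,1)\<close> matter; functions that agree almost everywhere are not identified.
\<close>

definition test_function :: "(real \<Rightarrow> real) \<Rightarrow> bool" where
  "test_function \<phi> \<longleftrightarrow>
     (\<forall>k x. (deriv ^^ k) \<phi> differentiable (at x)) \<and>
     compact (closure {x. \<phi> x \<noteq> 0}) \<and> closure {x. \<phi> x \<noteq> 0} \<subseteq> {0<..<1}"

definition locally_integrable :: "(real \<Rightarrow> real) \<Rightarrow> bool" where
  "locally_integrable f \<longleftrightarrow>
     (\<forall>K. compact K \<and> K \<subseteq> {0<..<1} \<longrightarrow> set_integrable lebesgue K f)"

definition has_weak_derivative :: "(real \<Rightarrow> real) \<Rightarrow> (real \<Rightarrow> real) \<Rightarrow> bool" where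
  "has_weak_derivative u g \<longleftrightarrow>
     locally_integrable u \<and> locally_integrable g \<and>
     (\<forall>\<phi>. test_function \<phi> \<longrightarrow>
        (LINT x:{0<..<1}|lebesgue. u x * deriv \<phi> x) =
        - (LINT x:{0<..<1}|lebesgue. g x * \<phi> x))"

definition Lp_space :: "nat \<Rightarrow> (real \<Rightarrow> real) set" where
  "Lp_space p = {f. set_borel_measurable lebesgue {0<..<1} f \<and>
                    set_integrable lebesgue {0<..<1} (\<lambda>x. \<bar>f x\<bar> ^ p)}"

definition W1_space :: "nat \<Rightarrow> (real \<Rightarrow> real) set" where
  "W1_space p = {u \<in> Lp_space p. \<exists>g \<in> Lp_space p. has_weak_derivative u g}"

text \<open>
  Elements are the continuous representatives on \<open>[0,1]\<close>; their values outside \<open>[0,1]\<close> are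
  unconstrained. The weak derivative is unique only up to null sets, so it does not matter
  which one is taken to compute the norm.
\<close>

definition E_set :: "nat \<Rightarrow> (real \<Rightarrow> real) set" where
  "E_set N = {u \<in> W1_space N. continuous_on {0..1} u \<and> u 0 = 0 \<and>
     (\<exists>g \<in> Lp_space N. has_weak_derivative u g \<and>
        (LINT x:{0<..<1}|lebesgue. \<bar>g x\<bar> ^ N) = 1)}"

end

theory Submission
  imports Defs
begin

text \<open>
  Hoelder's inequality gives \<open>v\<^sup>N(s) \<le> s\<^sup>N\<^sup>-\<^sup>1\<close> on \<open>E\<^sub>N\<close>, with equality at \<open>s = a\<close> for the
  ramp \<open>v(s) = a\<^sup>-\<^sup>1\<^sup>/\<^sup>N min(s, a)\<close>.  With \<open>L = log(e/a)\<close>, on the interval \<open>[a(1 - 1/L), a]\<close> the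
  exponent is \<open>(log(e/s) + log log(e/s) + h(1/s)) s/a\<close>, hence at least
  \<open>(L + log L + h(1/a)) (1 - 1/L) \<ge> L + log L + h(1/a) - 3\<close> once \<open>h(1/a) \<le> L\<close>. The interval has
  length \<open>a/L\<close>, so it contributes at least \<open>e\<^sup>h\<^sup>(\<^sup>1\<^sup>/\<^sup>a\<^sup>) \<^sup>- \<^sup>2\<close>, which is unbounded as \<open>a \<rightarrow> 0\<close>.
\<close>

definition ramp :: "nat \<Rightarrow> real \<Rightarrow> real \<Rightarrow> real" where
  "ramp N a x = min x a / root N a"

text \<open>The value 0 at the kink \<open>a\<close> is an arbitrary choice. No lower cutoff at 0
  appears because \<open>ramp\<close> stays linear for negative arguments, so this is the classical
  derivative at every point except \<open>a\<close>.\<close>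

definition ramp_deriv :: "nat \<Rightarrow> real \<Rightarrow> real \<Rightarrow> real" where
  "ramp_deriv N a x = indicator {..<a} x / root N a"

lemma continuous_on_ramp: "continuous_on S (ramp N a)"
  unfolding ramp_def divide_inverse by (intro continuous_intros)

lemma borel_measurable_ramp_deriv: "ramp_deriv N a \<in> borel_measurable lebesgue"
  unfolding ramp_deriv_def[abs_def]
  by (intro measurable_completion borel_measurable_divide borel_measurable_indicator) auto

lemma ramp_has_real_derivative:
  assumes "x \<noteq> a"
  shows "(ramp N a has_real_derivative ramp_deriv N a x) (at x)"
proof (cases "x < a")
  case True
  have "((\<lambda>x. x / root N a) has_real_derivative ramp_deriv N a x) (at x)"
    using True DERIV_cdivide[OF DERIV_ident] by (simp add: ramp_deriv_def)
  then show ?thesis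
    by (rule has_field_derivative_transform_within_open[where S = "{..<a}"])
      (use True in \<open>auto simp: ramp_def\<close>)
next
  case False
  have "((\<lambda>x. a / root N a) has_real_derivative ramp_deriv N a x) (at x)"
    using False by (auto simp: ramp_deriv_def)
  then show ?thesis
    by (rule has_field_derivative_transform_within_open[where S = "{a<..}"])
      (use False assms in \<open>auto simp: ramp_def\<close>)
qed

text \<open>The product is \<open>f / root N a\<close> cut off to the part of (0,1) below
  \<open>a\<close>. It serves with \<open>f\<close> constantly 1 for local integrability of the
  derivative, and with \<open>f\<close> a test function for integration by parts.\<close>

lemma set_integrable_ramp_deriv_mult:
  assumes "continuous_on {0..1} f"
  shows "set_integrable lebesgue {0<..<1} (\<lambda>x. ramp_deriv N a x * f x)"
proof -
  have "f absolutely_integrable_on {0..1}"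
    using assms by (rule absolutely_integrable_continuous_real)
  then have f: "f absolutely_integrable_on {0<..<1}"
    by (rule set_integrable_subset) auto
  have "(\<lambda>x. f x / root N a) absolutely_integrable_on ({0<..<1} \<inter> {..<a})"
    using set_integrable_subset[OF f, of "{0<..<1} \<inter> {..<a}"] by simp
  moreover have "indicator ({0<..<1} \<inter> {..<a}) x *\<^sub>R (f x / root N a) =
      indicator {0<..<1} x *\<^sub>R (ramp_deriv N a x * f x)" for x
    by (auto simp: ramp_deriv_def indicator_def)
  ultimately show ?thesis
    by (simp add: set_integrable_def)
qed

lemma locally_integrableI:
  assumes "set_integrable lebesgue {0<..<1} f"
  shows "locally_integrable f"
  unfolding locally_integrable_def
  using set_integrable_subset[OF assms] lmeasurable_compact by blast

text \<open>Integration by parts: the product of \<open>ramp N a\<close> and a test function is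
  continuous, vanishes at 0 and 1, and is differentiable except at \<open>a\<close>, a single point
  that the fundamental theorem of calculus tolerates.\<close>

lemma ramp_has_weak_derivative: "has_weak_derivative (ramp N a) (ramp_deriv N a)"
  unfolding has_weak_derivative_def
proof (intro conjI allI impI)
  have "ramp N a absolutely_integrable_on {0..1}"
    by (intro absolutely_integrable_continuous_real continuous_on_ramp)
  then show "locally_integrable (ramp N a)"
    by (intro locally_integrableI) (erule set_integrable_subset, auto)
  show "locally_integrable (ramp_deriv N a)"
    using set_integrable_ramp_deriv_mult[of "\<lambda>_. 1" N a] by (intro locally_integrableI) simp
next
  fix \<phi> :: "real \<Rightarrow> real"
  assume \<phi>: "test_function \<phi>"
  have d0: "(\<phi> has_real_derivative deriv \<phi> x) (at x)" for x
  proof -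
    have "(deriv ^^ 0) \<phi> differentiable (at x)"
      using \<phi> unfolding test_function_def by blast
    then show ?thesis
      by (simp add: DERIV_deriv_iff_real_differentiable)
  qed
  have "(deriv ^^ 1) \<phi> differentiable (at x)" for x
    using \<phi> unfolding test_function_def by blast
  then have cont_deriv: "continuous_on S (deriv \<phi>)" for S
    by (auto intro!: continuous_at_imp_continuous_on differentiable_imp_continuous_within)
  have cont: "continuous_on S \<phi>" for S
    using d0 by (auto intro!: continuous_at_imp_continuous_on DERIV_isCont)
  \<comment> \<open>The closed support lies in the open interval, so it misses both
    endpoints.\<close>
  have zero: "\<phi> 0 = 0" "\<phi> 1 = 0"
    using \<phi> closure_subset[of "{x. \<phi> x \<noteq> 0}"] unfolding test_function_def by force+
  let ?p = "\<lambda>x. ramp N a x * deriv \<phi> x" and ?q = "\<lambda>x. ramp_deriv N a x * \<phi> x"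
  have "?p absolutely_integrable_on {0..1}"
    by (intro absolutely_integrable_continuous_real continuous_intros continuous_on_ramp cont_deriv)
  then have p: "set_integrable lebesgue {0<..<1} ?p"
    by (rule set_integrable_subset) auto
  have q: "set_integrable lebesgue {0<..<1} ?q"
    by (rule set_integrable_ramp_deriv_mult[OF cont])
  have "((\<lambda>x. ?p x + ?q x) has_integral (ramp N a 1 * \<phi> 1 - ramp N a 0 * \<phi> 0)) {0..1}"
  proof (rule fundamental_theorem_of_calculus_interior_strong[where S = "{a}"])
    fix x :: real
    assume "x \<in> {0<..<1} - {a}"
    then have "((\<lambda>x. ramp N a x * \<phi> x) has_real_derivative ?p x + ?q x) (at x)"
      using DERIV_mult[OF ramp_has_real_derivative d0] by (simp add: algebra_simps)
    then show "((\<lambda>x. ramp N a x * \<phi> x) has_vector_derivative ?p x + ?q x) (at x)"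
      by (simp add: has_real_derivative_iff_has_vector_derivative)
  qed (auto intro!: continuous_intros continuous_on_ramp cont)
  then have "((\<lambda>x. ?p x + ?q x) has_integral 0) {0<..<1}"
    by (simp add: zero has_integral_Icc_iff_Ioo)
  then have "(LINT x:{0<..<1}|lebesgue. ?p x + ?q x) = 0"
    using set_lebesgue_integral_eq_integral(2)[OF set_integral_add(1)[OF p q]]
    by (simp add: integral_unique)
  then show "(LINT x:{0<..<1}|lebesgue. ?p x) = - (LINT x:{0<..<1}|lebesgue. ?q x)"
    using set_integral_add(2)[OF p q] by simp
qed

text \<open>The factor \<open>1 / root N a\<close> is the normalisation: the N-th power of the
  derivative is 1/a on (0,a) and 0 beyond, hence has integral 1.\<close>

lemma ramp_in_E_set:
  assumes "N \<ge> 2" "0 < a" "a < 1"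
  shows "ramp N a \<in> E_set N"
proof -
  have N: "N > 0" and root: "root N a ^ N = a" "root N a > 0"
    using assms by auto
  have power: "\<bar>ramp_deriv N a x\<bar> ^ N = indicator {..<a} x / a" for x
    using root N by (auto simp: ramp_deriv_def indicator_def power_divide)
  have "(LINT x:{0<..<1}|lebesgue. \<bar>ramp_deriv N a x\<bar> ^ N) =
      (LINT x|lebesgue. indicator {0<..<a} x / a)"
    unfolding set_lebesgue_integral_def power
    by (rule Bochner_Integration.integral_cong) (use assms in \<open>auto simp: indicator_def\<close>)
  also have "\<dots> = 1"
    using assms by simp
  finally have norm: "(LINT x:{0<..<1}|lebesgue. \<bar>ramp_deriv N a x\<bar> ^ N) = 1" .
  \<comment> \<open>The Bochner integral of a non-integrable function is 0 by convention, so the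
    value 1 already forces integrability.\<close>
  have "set_integrable lebesgue {0<..<1} (\<lambda>x. \<bar>ramp_deriv N a x\<bar> ^ N)"
    using not_integrable_integral_eq norm unfolding set_integrable_def set_lebesgue_integral_def
    by fastforce
  moreover have "set_borel_measurable lebesgue {0<..<1} (ramp_deriv N a)"
    unfolding set_borel_measurable_def
    by (intro borel_measurable_scaleR borel_measurable_ramp_deriv borel_measurable_indicator) auto
  ultimately have deriv: "ramp_deriv N a \<in> Lp_space N"
    by (simp add: Lp_space_def)
  have "set_integrable lebesgue {0..1} (\<lambda>x. \<bar>ramp N a x\<bar> ^ N)"
    by (intro absolutely_integrable_continuous_real continuous_intros continuous_on_ramp)
  then have "set_integrable lebesgue {0<..<1} (\<lambda>x. \<bar>ramp N a x\<bar> ^ N)"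
    by (rule set_integrable_subset) auto
  moreover have "set_borel_measurable lebesgue {0<..<1} (ramp N a)"
    unfolding set_borel_measurable_def
    by (intro measurable_completion borel_measurable_scaleR borel_measurable_indicator)
      (auto intro: borel_measurable_continuous_onI continuous_on_ramp)
  ultimately have "ramp N a \<in> Lp_space N"
    by (simp add: Lp_space_def)
  then show ?thesis
    using deriv norm assms ramp_has_weak_derivative[of N a] continuous_on_ramp
    by (auto simp: E_set_def W1_space_def ramp_def)
qed

text \<open>Multiplying by 1 - 1/L costs (L + ln L + H)/L, which is at most 3 because ln L and H are
  both at most L. In the application \<open>r\<close> is s/a, and the primed quantities are the
  values at s of those taken at a.\<close>

lemma exponent_lower_bound:
  fixes L H r :: real
  assumes "L \<ge> 1" "0 \<le> H" "H \<le> L" "1 - 1 / L \<le> r"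
    and "L \<le> L'" "H \<le> H'"
  shows "L + ln L + H - 3 \<le> (L' + ln L' + H') * r"
proof -
  have "ln L \<le> L" "0 \<le> ln L" "ln L \<le> ln L'"
    using assms ln_bound[of L] by auto
  then have "(L + ln L + H) / L \<le> 3"
    using assms by (simp add: field_simps)
  then have "L + ln L + H - 3 \<le> (L + ln L + H) * (1 - 1 / L)"
    by (simp add: right_diff_distrib)
  also have "\<dots> \<le> (L' + ln L' + H') * r"
    using assms \<open>0 \<le> ln L\<close> \<open>ln L \<le> ln L'\<close> by (intro mult_mono add_mono) auto
  finally show ?thesis .
qed

lemma ramp_integral_lower_bound:
  fixes h :: "real \<Rightarrow> real"
  assumes "N \<ge> 2" "0 < a" "a < 1" "mono_on {1..} h" "0 \<le> h (1 / a)" "h (1 / a) \<le> ln (exp 1 / a)"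
  shows "ennreal (exp (h (1 / a) - 2)) \<le> (\<integral>\<^sup>+ s\<in>{0<..<1}.
            ennreal (exp ((ln (exp 1 / s) + ln (ln (exp 1 / s)) + h (1 / s)) *
                          (ramp N a s ^ N / s ^ (N - 1)))) \<partial>lebesgue)"
    (is "_ \<le> (\<integral>\<^sup>+ s\<in>_. ennreal (exp (?F s)) \<partial>lebesgue)")
proof -
  define L where "L = ln (exp 1 / a)"
  define H where "H = h (1 / a)"
  define b where "b = a * (1 - 1 / L)"
  have L: "L > 1"
    using assms by (simp add: L_def ln_div)
  have b: "0 < b" "b \<le> a"
    using assms L by (auto simp: b_def mult_le_cancel_left1)
  have root: "root N a ^ N = a"
    using assms by simp
  have bound: "L + ln L + H - 3 \<le> ?F s" if s: "s \<in> {b..a}" for s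
  proof -
    have s0: "0 < s" "s \<le> a"
      using s b by auto
    \<comment> \<open>The subtraction is on naturals; \<open>N\<close> being positive makes it
      exact.\<close>
    have "s ^ N = s * s ^ (N - 1)"
      using assms by (simp flip: power_Suc)
    then have ratio: "ramp N a s ^ N / s ^ (N - 1) = s / a"
      using s0 root by (simp add: ramp_def power_divide)
    have "1 - 1 / L \<le> s / a"
      using s assms by (simp add: b_def field_simps)
    moreover have "L \<le> ln (exp 1 / s)"
      using s0 assms unfolding L_def by (simp add: ln_div)
    moreover have "H \<le> h (1 / s)"
      unfolding H_def using s0 assms by (intro mono_onD[OF assms(4)]) (auto simp: field_simps)
    ultimately show ?thesis
      unfolding ratio using L assms by (intro exponent_lower_bound) (auto simp: L_def H_def)
  qed
  \<comment> \<open>Here exp L = e/a and exp(ln L) = L cancel the length a/L up to the factor e,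
    which turns the loss of 3 into 2.\<close>
  have "exp (L + ln L + H - 3) * (a - b) = exp L * exp (ln L) * exp (H - 3) * (a / L)"
    by (simp add: b_def exp_add[symmetric] algebra_simps)
  also have "\<dots> = exp 1 * exp (H - 3)"
    using L assms by (simp add: L_def[symmetric]) (simp add: L_def)
  also have "\<dots> = exp (H - 2)"
    by (simp flip: exp_add)
  finally have "ennreal (exp (H - 2)) = ennreal (exp (L + ln L + H - 3)) * emeasure lebesgue {b..a}"
    using b by (simp flip: ennreal_mult)
  also have "\<dots> = (\<integral>\<^sup>+ s. ennreal (exp (L + ln L + H - 3)) * indicator {b..a} s \<partial>lebesgue)"
    by (simp add: nn_integral_cmult_indicator)
  \<comment> \<open>Since 0 < b and a < 1, the interval lies inside (0,1); elsewhere the nonnegative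
    integrand is simply dropped.\<close>
  also have "\<dots> \<le> (\<integral>\<^sup>+ s\<in>{0<..<1}. ennreal (exp (?F s)) \<partial>lebesgue)"
    using bound b assms
    by (intro nn_integral_mono) (auto simp: indicator_def intro!: ennreal_leI)
  finally show ?thesis
    by (simp add: H_def)
qed

theorem corollary1:
  fixes N :: nat and h :: "real \<Rightarrow> real"
  assumes "N \<ge> 2"
    and "\<And>t. t \<ge> 1 \<Longrightarrow> h t \<ge> 0"
    and "continuous_on {1..} h"
    and "mono_on {1..} h"
    and "filterlim h at_top at_top"
    and "((\<lambda>t. h t / ln (ln (exp 1 * t))) \<longlongrightarrow> 0) at_top"
  shows "(SUP v\<in>E_set N. \<integral>\<^sup>+ s\<in>{0<..<1}.
            ennreal (exp ((ln (exp 1 / s) + ln (ln (exp 1 / s)) + h (1 / s)) *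
                          (v s ^ N / s ^ (N - 1)))) \<partial>lebesgue) = \<infinity>"
  unfolding infinity_ennreal_def SUP_eq_top_iff
proof (intro allI impI)
  fix y :: ennreal
  assume "y < top"
  then obtain B where B: "B \<ge> 0" "y = ennreal B"
    by (cases y) auto
  have "\<forall>\<^sub>F t in at_top. h t / ln (ln (exp 1 * t)) < 1"
    using assms(6) by (rule order_tendstoD) simp
  \<comment> \<open>The margin 1 fits the estimate exp(h t - 2) \<ge> h t - 1 > B used
    below.\<close>
  moreover have "\<forall>\<^sub>F t in at_top. B + 1 < h t"
    using assms(5) by (simp add: filterlim_at_top_dense)
  ultimately have "\<forall>\<^sub>F t in at_top. h t / ln (ln (exp 1 * t)) < 1 \<and> B + 1 < h t \<and> 1 < t"
    using eventually_gt_at_top[of "1::real"] by eventually_elim simp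
  then obtain t where t: "h t / ln (ln (exp 1 * t)) < 1" "B + 1 < h t" "1 < t"
    using eventually_happens by (metis (lifting) trivial_limit_at_top_linorder)
  \<comment> \<open>This makes log log(et) positive, so the quotient bound can be cleared of its
    denominator; then h t \<le> log log(et) \<le> log(et) is the size condition on \<open>h\<close>
    for the ramp with a = 1/t.\<close>
  have L: "ln (exp 1 * t) > 1"
    using t by (simp add: ln_mult)
  then have "h t \<le> ln (ln (exp 1 * t))"
    using t(1) by (simp add: field_simps)
  also have "\<dots> \<le> ln (exp 1 * t)"
    using L by (intro ln_bound) auto
  finally have "ennreal (exp (h t - 2)) \<le> (\<integral>\<^sup>+ s\<in>{0<..<1}.
            ennreal (exp ((ln (exp 1 / s) + ln (ln (exp 1 / s)) + h (1 / s)) *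
                          (ramp N (1 / t) s ^ N / s ^ (N - 1)))) \<partial>lebesgue)"
    using ramp_integral_lower_bound[of N "1 / t" h] assms t by simp
  moreover have "y < ennreal (exp (h t - 2))"
    using exp_ge_add_one_self[of "h t - 2"] t B by (simp add: ennreal_less_iff)
  moreover have "ramp N (1 / t) \<in> E_set N"
    using assms t by (intro ramp_in_E_set) auto
  ultimately show "\<exists>v\<in>E_set N. y < (\<integral>\<^sup>+ s\<in>{0<..<1}.
            ennreal (exp ((ln (exp 1 / s) + ln (ln (exp 1 / s)) + h (1 / s)) *
                          (v s ^ N / s ^ (N - 1)))) \<partial>lebesgue)"
    by (meson less_le_trans)
qed

end
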